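(* Let $d\ge 3$ be an integer and let $E\subseteq\mathbb{R}^d$ be a compact set containing a unit line segment in a non-degenerate sphere of directions; that is, there is a non-degenerate sphere $\Gamma\subseteq S^{d-1}$ such that for every $\theta\in\Gamma$ there exists $t_\theta\in\mathbb{R}^d$ with $t_\theta+r\theta\in E$ for all $r\in[0,1]$. If $d=3$, then $$\dim_{\mathrm F}E\ge 1.$$ If $d\ge 4$, then $$\dim_{\mathrm F}E\ge 2.$$
   Context: $S^{d-1}$ is the unit sphere of $\mathbb{R}^d$, identified in the natural way with the set of directions $G(d,1)$ (lines through the origin). A non-degenerate sphere is a $(d-2)$-dimensional sphere $\Gamma\subseteq S^{d-1}$ with diameter strictly less than $2$ (that is, it is not the intersection of $S^{d-1}$ with a hyperplane through the origin). Fourier dimension: for a Borel measure $\mu$ on $\mathbb{R}^d$, $\hat\mu(\xi)=\int_{\mathbb{R}^d} e^{-2\pi i\xi\cdot x}\,d\mu(x)$. For a closed set $E\subseteq\mathbb{R}^d$, $\dim_{\mathrm F}E$ is the supremum of those $s\in[0,d]$ for which there exist a Borel probability measure $\mu$ supported on $E$ and a constant $C>0$ with $|\hat\mu(\xi)|\le C|\xi|^{-s/2}$ for all $\xi\in\mathbb{R}^d\setminus\{0\}$. *)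

theory Defs
  imports "HOL-Probability.Probability"
begin

definition fourier_transform :: "(real ^ 'n) measure \<Rightarrow> real ^ 'n \<Rightarrow> complex" where
  "fourier_transform M \<xi> = (LINT x|M. exp (- 2 * of_real pi * \<i> * of_real (\<xi> \<bullet> x)))"

(* For closed E, a Borel measure has its topological support inside E exactly when
   the complement of E is a null set. *)
definition borel_prob_on :: "(real ^ 'n) set \<Rightarrow> (real ^ 'n) measure \<Rightarrow> bool" where
  "borel_prob_on E M \<longleftrightarrow> prob_space M \<and> sets M = sets borel \<and> emeasure M (- E) = 0"

(* Intended for closed nonempty E. The set below is then bounded and contains 0 (take a
   point mass), so the supremum is a genuine one; for empty E the value is unspecified. *)
definition fourier_dim :: "(real ^ 'n) set \<Rightarrow> real" where
  "fourier_dim E = Sup {s \<in> {0..real CARD('n)}.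
     \<exists>M C. borel_prob_on E M \<and> C > 0 \<and>
       (\<forall>\<xi>. \<xi> \<noteq> 0 \<longrightarrow> norm (fourier_transform M \<xi>) \<le> C * norm \<xi> powr (- s / 2))}"

(* A k-dimensional round sphere: the points at a fixed positive distance from a centre c
   within a (k+1)-dimensional affine subspace through c. *)
definition k_sphere :: "int \<Rightarrow> (real ^ 'n) set \<Rightarrow> bool" where
  "k_sphere k \<Gamma> \<longleftrightarrow> (\<exists>A c \<rho>. affine A \<and> aff_dim A = k + 1 \<and> c \<in> A \<and> \<rho> > 0 \<and>
     \<Gamma> = A \<inter> sphere c \<rho>)"

definition nondegenerate_sphere :: "(real ^ 'n) set \<Rightarrow> bool" where
  "nondegenerate_sphere \<Gamma> \<longleftrightarrow>
     k_sphere (int CARD('n) - 2) \<Gamma> \<and> \<Gamma> \<subseteq> sphere 0 1 \<and> diameter \<Gamma> < 2"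

definition contains_unit_segment_in_directions ::
    "(real ^ 'n) set \<Rightarrow> (real ^ 'n) set \<Rightarrow> bool" where
  "contains_unit_segment_in_directions E \<Gamma> \<longleftrightarrow>
     (\<forall>\<theta>\<in>\<Gamma>. \<exists>t. \<forall>r\<in>{0..1::real}. t + r *\<^sub>R \<theta> \<in> E)"

end

theory Submission
  imports Defs
begin

text \<open>
  Write the non-degenerate sphere as the slice of the unit sphere at height \<open>a\<close>, where \<open>0 < \<bar>a\<bar> < 1\<close>. Choose
  for each direction \<open>\<theta>\<close> in it a segment \<open>\<tau> \<theta> + {0..1} *\<^sub>R \<theta>\<close> in \<open>E\<close>, measurably in \<open>\<theta>\<close>, and let \<open>M\<close> be the law of a
  random point on the segment in a random direction. The phases coming from \<open>\<tau>\<close> have modulus one, so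
  the modulus of the Fourier transform of \<open>M\<close> at \<open>\<xi>\<close> is at most the mean over \<open>\<theta>\<close> of \<open>min 1 (1 / \<bar>\<xi> \<bullet> \<theta>\<bar>)\<close>,
  whatever the starting points are. Everything depends on how often \<open>\<bar>\<xi> \<bullet> \<theta>\<bar>\<close> is small.
  
  In stereographic coordinates \<open>y\<close> on the slice, and up to a bounded positive factor, \<open>\<xi> \<bullet> \<theta>\<close> is a polynomial
  \<open>A * \<bar>y\<bar>\<^sup>2 + 2 * (\<beta> \<bullet> y) + B\<close>, and since \<open>a\<close> is not zero, its coefficients have total size at least a
  multiple of \<open>norm \<xi>\<close>. The directions need not be distributed according to surface measure: \<open>y\<close> uniform in
  a cube of dimension \<open>d - 2\<close> is enough. The probability that such a polynomial of size \<open>R\<close> is at most \<open>t\<close>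
  in modulus is at most a multiple of \<open>(t / R) powr p\<close> (\<open>prob_round_quadratic_sublevel_le\<close>). The worst case is
  a thin spherical shell. If \<open>d \<ge> 4\<close>, it may be sliced by planes, where an annulus of thickness \<open>\<delta>\<close> in the
  squared radius has area at most \<open>2 * pi * \<delta>\<close>, so \<open>p = 1\<close> is possible. If \<open>d = 3\<close>, there is a single
  coordinate, and tangency of the plane orthogonal to \<open>\<xi>\<close> costs a square root: \<open>p = 1/2\<close>.
  
  Integrating the tail gives decay of order \<open>p\<close> for every admissible \<open>p < 1\<close>
  (\<open>segment_measure_fourier_decay\<close>), hence Fourier dimension at least \<open>2 * p\<close>. For \<open>d = 3\<close> the value \<open>p = 1/2\<close> is
  attained. For \<open>d \<ge> 4\<close> the logarithm lost by segments with sharp end points, as opposed to smooth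
  densities, is harmless because the Fourier dimension is a supremum.
\<close>

section \<open>Measurable selection from compact sets\<close>

text \<open>Weak measurability of a set-valued map in the sense of Kuratowski and Ryll-Nardzewski, but tested
  on closed sets; for compact values this is the convenient form.\<close>
definition weakly_measurable_on :: "'a measure \<Rightarrow> ('a \<Rightarrow> 'b::topological_space set) \<Rightarrow> bool" where
  "weakly_measurable_on M K \<longleftrightarrow> (\<forall>C. closed C \<longrightarrow> {x \<in> space M. K x \<inter> C \<noteq> {}} \<in> sets M)"

text \<open>Restricting a compact-valued map to the points minimising a linear functional keeps it weakly
  measurable. No minimiser lies in \<open>C\<close> exactly when the minimum over \<open>K x\<close> is strictly below the minimum
  over \<open>K x \<inter> C\<close>, and such a strict inequality is witnessed by a rational number \<open>q\<close> between the two
  minima; this turns the condition into a countable union of sets known to be measurable.\<close>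
lemma compact_valued_restrict_minimizers:
  fixes K :: "'a \<Rightarrow> 'b::euclidean_space set" and b :: 'b
  assumes K: "\<And>x. x \<in> space M \<Longrightarrow> compact (K x)" "\<And>x. x \<in> space M \<Longrightarrow> K x \<noteq> {}"
    and meas: "weakly_measurable_on M K"
  defines "L \<equiv> \<lambda>x. {p \<in> K x. \<forall>q\<in>K x. p \<bullet> b \<le> q \<bullet> b}"
  shows "\<And>x. x \<in> space M \<Longrightarrow> compact (L x)" "\<And>x. x \<in> space M \<Longrightarrow> L x \<noteq> {}"
    and "weakly_measurable_on M L"
proof -
  fix x assume x: "x \<in> space M"
  have "L x = K x \<inter> (\<Inter>q\<in>K x. {p. p \<bullet> b \<le> q \<bullet> b})"
    by (auto simp: L_def)
  moreover have "closed (\<Inter>q\<in>K x. {p. p \<bullet> b \<le> q \<bullet> b})"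
    by (intro closed_INT ballI closed_Collect_le continuous_intros)
  ultimately show "compact (L x)"
    using K(1)[OF x] by (simp add: compact_Int_closed)
  have "continuous_on (K x) (\<lambda>p. p \<bullet> b)" by (intro continuous_intros)
  from continuous_attains_inf[OF K(1)[OF x] K(2)[OF x] this] show "L x \<noteq> {}"
    by (auto simp: L_def)
next
  show "weakly_measurable_on M L"
    unfolding weakly_measurable_on_def
  proof (intro allI impI)
    fix C :: "'b set" assume C: "closed C"
    define H where "H q = {p::'b. p \<bullet> b \<le> q}" for q
    have H: "closed (H q)" for q
      unfolding H_def by (intro closed_Collect_le continuous_intros)
    have "L x \<inter> C = {} \<longleftrightarrow> (\<exists>q\<in>\<rat>. K x \<inter> H q \<noteq> {} \<and> K x \<inter> (C \<inter> H q) = {})"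
      if x: "x \<in> space M" for x
    proof
      assume L: "L x \<inter> C = {}"
      have "continuous_on (K x) (\<lambda>p. p \<bullet> b)" by (intro continuous_intros)
      from continuous_attains_inf[OF K(1)[OF x] K(2)[OF x] this]
      obtain m where m: "m \<in> K x" "\<And>q. q \<in> K x \<Longrightarrow> m \<bullet> b \<le> q \<bullet> b" by auto
      \<comment> \<open>A level \<open>u\<close> above the minimum but not above any value on \<open>C\<close>: the minimum over \<open>K x \<inter> C\<close>,
        or anything larger than the minimum if that set is empty.\<close>
      obtain u where u: "m \<bullet> b < u" "\<And>q. q \<in> K x \<inter> C \<Longrightarrow> u \<le> q \<bullet> b"
      proof (cases "K x \<inter> C = {}")
        case True
        then show ?thesis using that[of "m \<bullet> b + 1"] by auto
      next
        case False
        have "compact (K x \<inter> C)" using K(1)[OF x] C by (simp add: compact_Int_closed)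
        moreover have "continuous_on (K x \<inter> C) (\<lambda>p. p \<bullet> b)" by (intro continuous_intros)
        ultimately obtain p where p: "p \<in> K x \<inter> C" "\<And>q. q \<in> K x \<inter> C \<Longrightarrow> p \<bullet> b \<le> q \<bullet> b"
          using continuous_attains_inf[of "K x \<inter> C"] False by metis
        have "m \<bullet> b < p \<bullet> b"
        proof (rule ccontr)
          assume "\<not> ?thesis"
          with m p have "p \<in> L x" by (fastforce simp: L_def)
          with p L show False by auto
        qed
        with p that show ?thesis by blast
      qed
      obtain q where q: "q \<in> \<rat>" "m \<bullet> b < q" "q < u"
        using Rats_dense_in_real[OF u(1)] by auto
      then show "\<exists>q\<in>\<rat>. K x \<inter> H q \<noteq> {} \<and> K x \<inter> (C \<inter> H q) = {}"
        using m(1) u(2) by (intro bexI[of _ q]) (force simp: H_def)+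
    next
      assume "\<exists>q\<in>\<rat>. K x \<inter> H q \<noteq> {} \<and> K x \<inter> (C \<inter> H q) = {}"
      then show "L x \<inter> C = {}"
        by (force simp: H_def L_def)
    qed
    then have "{x \<in> space M. L x \<inter> C \<noteq> {}} = space M -
       (\<Union>q\<in>\<rat>. {x \<in> space M. K x \<inter> H q \<noteq> {}} - {x \<in> space M. K x \<inter> (C \<inter> H q) \<noteq> {}})"
      by (intro set_eqI) (simp cong: conj_cong)
    also have "\<dots> \<in> sets M"
      using meas C H closed_Int[OF C H] unfolding weakly_measurable_on_def
      by (intro sets.compl_sets sets.countable_UN' countable_rat) (blast intro: sets.Diff)+
    finally show "{x \<in> space M. L x \<inter> C \<noteq> {}} \<in> sets M" .
  qed
qed

text \<open>Choose in each \<open>K x\<close> the lexicographically smallest point: minimise one coordinate after the other.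
  When all coordinates have been treated, a single point is left, and weak measurability of a
  single-valued map is ordinary measurability.\<close>
theorem compact_valued_measurable_selection:
  fixes K :: "'a \<Rightarrow> 'b::euclidean_space set"
  assumes K: "\<And>x. x \<in> space M \<Longrightarrow> compact (K x)" "\<And>x. x \<in> space M \<Longrightarrow> K x \<noteq> {}"
    and meas: "weakly_measurable_on M K"
  obtains f where "f \<in> borel_measurable M" "\<And>x. x \<in> space M \<Longrightarrow> f x \<in> K x"
proof -
  have "\<exists>L. (\<forall>x\<in>space M. compact (L x) \<and> L x \<noteq> {} \<and> L x \<subseteq> K x \<and>
            (\<forall>p\<in>L x. \<forall>q\<in>L x. \<forall>b\<in>B. p \<bullet> b = q \<bullet> b)) \<and> weakly_measurable_on M L"
    if "finite B" for B :: "'b set"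
    using that
  proof (induction B rule: finite_induct)
    case empty
    show ?case using assms by (intro exI[of _ K]) auto
  next
    case (insert b B)
    from insert.IH obtain L where *:
      "(\<forall>x\<in>space M. compact (L x) \<and> L x \<noteq> {} \<and> L x \<subseteq> K x \<and>
        (\<forall>p\<in>L x. \<forall>q\<in>L x. \<forall>b\<in>B. p \<bullet> b = q \<bullet> b)) \<and> weakly_measurable_on M L"
      by (elim exE)
    note c = bspec[OF conjunct1[OF *]]
    note L = c[THEN conjunct1] c[THEN conjunct2, THEN conjunct1]
      c[THEN conjunct2, THEN conjunct2, THEN conjunct1] c[THEN conjunct2, THEN conjunct2, THEN conjunct2]
    note step = compact_valued_restrict_minimizers[where b = b, OF L(1,2) conjunct2[OF *]]
    let ?L = "\<lambda>x. {p \<in> L x. \<forall>q\<in>L x. p \<bullet> b \<le> q \<bullet> b}"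
    have agree: "p \<bullet> b' = q \<bullet> b'"
      if x: "x \<in> space M" and pq: "p \<in> ?L x" "q \<in> ?L x" and b': "b' \<in> insert b B" for x p q b'
    proof (cases "b' = b")
      case True
      with pq show ?thesis by (auto intro: antisym)
    next
      case False
      with b' have "b' \<in> B" by simp
      then show ?thesis using pq by (intro L(4)[OF x, THEN bspec, THEN bspec, THEN bspec]) simp_all
    qed
    have sub: "?L x \<subseteq> K x" if "x \<in> space M" for x
      using L(3)[OF that] by auto
    show ?case
      by (intro exI[of _ ?L] conjI ballI step(3)) (rule step sub agree; assumption)+
  qed
  from this[OF finite_Basis] obtain L where *:
    "(\<forall>x\<in>space M. compact (L x) \<and> L x \<noteq> {} \<and> L x \<subseteq> K x \<and>
        (\<forall>p\<in>L x. \<forall>q\<in>L x. \<forall>b\<in>Basis. p \<bullet> b = q \<bullet> b)) \<and> weakly_measurable_on M L" by (elim exE)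
  note L = conjunct1[OF *] and L_meas = conjunct2[OF *]
  have "\<exists>p. L x = {p}" if x: "x \<in> space M" for x
  proof -
    have "L x \<noteq> {}" using bspec[OF L x] by (elim conjE)
    then obtain p where p: "p \<in> L x" by blast
    have agree: "\<forall>p\<in>L x. \<forall>q\<in>L x. \<forall>b\<in>Basis. p \<bullet> b = q \<bullet> b"
      using bspec[OF L x] by (elim conjE)
    have "q = p" if "q \<in> L x" for q
      by (rule euclidean_eqI) (rule agree[THEN bspec, OF that, THEN bspec, OF p, THEN bspec])
    with p show ?thesis by blast
  qed
  then obtain f where f: "\<And>x. x \<in> space M \<Longrightarrow> L x = {f x}" by metis
  have "f \<in> borel_measurable M"
  proof (rule borel_measurableI)
    fix S :: "'b set" assume "open S"
    then have "{x \<in> space M. L x \<inter> - S \<noteq> {}} \<in> sets M"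
      using L_meas by (simp add: weakly_measurable_on_def closed_Compl)
    then have "space M - {x \<in> space M. L x \<inter> - S \<noteq> {}} \<in> sets M" by (rule sets.compl_sets)
    also have "space M - {x \<in> space M. L x \<inter> - S \<noteq> {}} = f -` S \<inter> space M"
      using f by force
    finally show "f -` S \<inter> space M \<in> sets M" .
  qed
  moreover have "f x \<in> K x" if "x \<in> space M" for x
  proof -
    have "L x \<subseteq> K x" using bspec[OF L that] by (elim conjE)
    with f[OF that] show ?thesis by blast
  qed
  ultimately show thesis by (rule that)
qed

section \<open>Thin shells and slices of the unit cube\<close>

lemma emeasure_thin_shell_le:
  fixes c :: "'a::euclidean_space"
  assumes "\<delta> \<ge> 0"
  shows "emeasure lborel {p. \<bar>(norm (p - c))\<^sup>2 - k\<bar> \<le> \<delta>}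
    \<le> ennreal (unit_ball_vol (real DIM('a)) *
        (sqrt (max 0 (k + \<delta>)) ^ DIM('a) - sqrt (max 0 (k - \<delta>)) ^ DIM('a)))"
proof (cases "k + \<delta> < 0")
  case True
  then have "{p. \<bar>(norm (p - c))\<^sup>2 - k\<bar> \<le> \<delta>} = {}"
    using assms by (auto simp: abs_le_iff) (smt (verit) zero_le_power2)
  then show ?thesis by simp
next
  case False
  define r1 r2 where "r1 = sqrt (max 0 (k - \<delta>))" and "r2 = sqrt (max 0 (k + \<delta>))"
  have r: "0 \<le> r1" "r1 \<le> r2" using assms by (auto simp: r1_def r2_def)
  have "{p. \<bar>(norm (p - c))\<^sup>2 - k\<bar> \<le> \<delta>} \<subseteq> cball c r2 - ball c r1"
  proof
    fix p assume "p \<in> {p. \<bar>(norm (p - c))\<^sup>2 - k\<bar> \<le> \<delta>}"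
    then have p: "(norm (p - c))\<^sup>2 \<le> k + \<delta>" "k - \<delta> \<le> (norm (p - c))\<^sup>2" by auto
    have "norm (p - c) \<le> r2" unfolding r2_def
      using p(1) by (intro real_le_rsqrt) auto
    moreover have "r1 \<le> norm (p - c)" unfolding r1_def
      using p(2) by (intro real_le_lsqrt) auto
    ultimately show "p \<in> cball c r2 - ball c r1"
      by (auto simp: dist_norm norm_minus_commute)
  qed
  then have "emeasure lborel {p. \<bar>(norm (p - c))\<^sup>2 - k\<bar> \<le> \<delta>} \<le> emeasure lborel (cball c r2 - ball c r1)"
    by (intro emeasure_mono) auto
  also have "\<dots> = emeasure lborel (cball c r2) - emeasure lborel (ball c r1)"
    using r emeasure_ball[OF r(1), of c] by (intro emeasure_Diff) auto
  also have "\<dots> = ennreal (unit_ball_vol (real DIM('a)) * (r2 ^ DIM('a) - r1 ^ DIM('a)))"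
    using r by (simp add: emeasure_cball emeasure_ball ennreal_minus right_diff_distrib)
  finally show ?thesis by (simp add: r1_def r2_def)
qed

text \<open>A thin shell on the line is a pair of intervals, each possibly as long as \<open>sqrt (2 * \<delta>)\<close>: this happens
  when the shell degenerates to a neighbourhood of its centre. This square root is what limits the
  decay in dimension three.\<close>
lemma emeasure_thin_shell_1_le:
  fixes c k \<delta> :: real
  assumes "\<delta> \<ge> 0"
  shows "emeasure lborel {u. \<bar>(u - c)\<^sup>2 - k\<bar> \<le> \<delta>} \<le> ennreal (2 * sqrt (2 * \<delta>))"
proof -
  have "sqrt (max 0 (k + \<delta>)) \<le> sqrt (max 0 (k - \<delta>) + 2 * \<delta>)"
    using assms by (intro real_sqrt_le_mono) auto
  also have "\<dots> \<le> sqrt (max 0 (k - \<delta>)) + sqrt (2 * \<delta>)"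
    using assms by (intro sqrt_add_le_add_sqrt) auto
  finally show ?thesis
    by (intro order_trans[OF emeasure_thin_shell_le[OF assms, of c k, unfolded real_norm_def power2_abs] ennreal_leI]) simp
qed

text \<open>In the plane the area of a disc is linear in the square of its radius, so the degenerate shells are
  no larger than the others and the bound is linear in \<open>\<delta>\<close>.\<close>
lemma emeasure_thin_shell_2_le:
  fixes c :: "real \<times> real" and k \<delta> :: real
  assumes "\<delta> \<ge> 0"
  shows "emeasure lborel {p. \<bar>(norm (p - c))\<^sup>2 - k\<bar> \<le> \<delta>} \<le> ennreal (2 * pi * \<delta>)"
proof -
  have "sqrt (max 0 (k + \<delta>)) ^ 2 - sqrt (max 0 (k - \<delta>)) ^ 2 \<le> 2 * \<delta>"
    using assms by (auto simp: max_def)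
  then have "pi * (sqrt (max 0 (k + \<delta>)) ^ 2 - sqrt (max 0 (k - \<delta>)) ^ 2) \<le> pi * (2 * \<delta>)"
    by (intro mult_left_mono) auto
  then show ?thesis
    by (intro order_trans[OF emeasure_thin_shell_le[OF assms, of c k] ennreal_leI]) (simp add: unit_ball_vol_2 mult_ac)
qed

lemma emeasure_bounded_gaps_le:
  fixes S :: "real set"
  assumes "\<And>u v. u \<in> S \<Longrightarrow> v \<in> S \<Longrightarrow> \<bar>u - v\<bar> \<le> D"
  shows "emeasure lborel S \<le> ennreal (2 * D)"
proof (cases "S = {}")
  case False
  then obtain z where z: "z \<in> S" by blast
  then have "D \<ge> 0" using assms[OF z z] by simp
  have "S \<subseteq> {z - D .. z + D}" using assms[OF z] by (force simp: abs_le_iff)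
  then have "emeasure lborel S \<le> emeasure lborel {z - D .. z + D}"
    by (intro emeasure_mono) auto
  also have "\<dots> = ennreal (2 * D)" using \<open>D \<ge> 0\<close> by simp
  finally show ?thesis .
qed simp

text \<open>The law of a uniform point of the unit interval. Restricting the underlying space, instead of using a
  density on the whole line, makes the coordinates of a sample point lie in \<open>{0..1}\<close> without exception.\<close>
definition uniform01 :: "real measure" where
  "uniform01 = restrict_space lborel {0..1}"

abbreviation uniform_cube :: "'i set \<Rightarrow> ('i \<Rightarrow> real) measure" where
  "uniform_cube J \<equiv> Pi\<^sub>M J (\<lambda>_. uniform01)"

lemma space_uniform01 [simp]: "space uniform01 = {0..1}"
  by (simp add: uniform01_def space_restrict_space)

lemma prob_space_uniform01: "prob_space uniform01"
  by (rule prob_spaceI) (simp add: uniform01_def emeasure_restrict_space space_restrict_space)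

interpretation uniform01: prob_space uniform01 by (rule prob_space_uniform01)

interpretation cube: product_prob_space "\<lambda>_::'i. uniform01" UNIV
  by standard

lemma uniform01_id_measurable: "(\<lambda>u. u) \<in> borel_measurable uniform01"
  unfolding uniform01_def by (intro measurable_restrict_space1) auto

lemma nn_integral_uniform01:
  "(\<integral>\<^sup>+u. f u \<partial>uniform01) = (\<integral>\<^sup>+u. f u * indicator {0..1} u \<partial>lborel)"
  unfolding uniform01_def by (subst nn_integral_restrict_space) auto

lemma cube_coordinate_measurable:
  "j \<in> J \<Longrightarrow> (\<lambda>y. y j) \<in> borel_measurable (uniform_cube J)"
  using measurable_compose[OF measurable_component_singleton[of j J "\<lambda>_. uniform01"] uniform01_id_measurable]
  by simp

text \<open>Fubini in one coordinate: a uniform bound on the length of all lines parallel to the \<open>j\<close>-th axis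
  bounds the volume.\<close>
lemma emeasure_uniform_cube_slice_le:
  assumes J: "finite J" "j \<in> J" and S: "S \<in> sets (uniform_cube J)"
    and slice: "\<And>y. \<exists>T\<in>sets borel. (\<forall>u\<in>{0..1}. y(j := u) \<in> S \<longrightarrow> u \<in> T) \<and> emeasure lborel T \<le> c"
  shows "emeasure (uniform_cube J) S \<le> c"
proof -
  define I where "I = J - {j}"
  have I: "finite I" "j \<notin> I" "J = insert j I" using J by (auto simp: I_def)
  interpret P: prob_space "uniform_cube I" by (intro prob_space_PiM prob_space_uniform01)
  have *: "(\<integral>\<^sup>+u. indicator S (y(j := u)) \<partial>uniform01) \<le> c" for y
  proof -
    obtain T where T: "T \<in> sets borel" "\<And>u. u \<in> {0..1} \<Longrightarrow> y(j := u) \<in> S \<Longrightarrow> u \<in> T"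
      "emeasure lborel T \<le> c" using slice[of y] by blast
    have "(\<integral>\<^sup>+u. indicator S (y(j := u)) \<partial>uniform01) \<le> (\<integral>\<^sup>+u. indicator T u \<partial>lborel)"
      unfolding nn_integral_uniform01
      by (intro nn_integral_mono) (use T(2) in \<open>auto simp: indicator_def\<close>)
    with T show ?thesis by simp
  qed
  have "emeasure (uniform_cube J) S = (\<integral>\<^sup>+y. indicator S y \<partial>uniform_cube J)"
    using S by simp
  also have "\<dots> = (\<integral>\<^sup>+y. (\<integral>\<^sup>+u. indicator S (y(j := u)) \<partial>uniform01) \<partial>uniform_cube I)"
    unfolding I(3) using S I by (intro cube.product_nn_integral_insert) auto
  also have "\<dots> \<le> (\<integral>\<^sup>+y. c \<partial>uniform_cube I)" by (intro nn_integral_mono *)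
  also have "\<dots> = c" by (simp add: P.emeasure_space_1)
  finally show ?thesis .
qed

text \<open>The same with planes parallel to the \<open>i\<close>-th and \<open>j\<close>-th axes, so that planar areas can be used.\<close>
lemma emeasure_uniform_cube_slice2_le:
  assumes J: "finite J" "i \<in> J" "j \<in> J" "i \<noteq> j" and S: "S \<in> sets (uniform_cube J)"
    and slice: "\<And>y. \<exists>T\<in>sets borel. (\<forall>u v. y(i := u, j := v) \<in> S \<longrightarrow> (u, v) \<in> T) \<and>
       emeasure lborel T \<le> c"
  shows "emeasure (uniform_cube J) S \<le> c"
proof -
  define I where "I = J - {i, j}"
  have I: "finite I" "i \<notin> I" "j \<notin> insert i I" "J = insert j (insert i I)"
    using J by (auto simp: I_def)
  interpret P: prob_space "uniform_cube I" by (intro prob_space_PiM prob_space_uniform01)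
  have *: "(\<integral>\<^sup>+u. (\<integral>\<^sup>+v. indicator S (y(i := u, j := v)) \<partial>uniform01) \<partial>uniform01) \<le> c" for y
  proof -
    obtain T where T: "T \<in> sets borel" "\<And>u v. y(i := u, j := v) \<in> S \<Longrightarrow> (u, v) \<in> T"
      "emeasure lborel T \<le> c" using slice[of y] by blast
    have "(\<integral>\<^sup>+u. (\<integral>\<^sup>+v. indicator S (y(i := u, j := v)) \<partial>uniform01) \<partial>uniform01)
        \<le> (\<integral>\<^sup>+u. (\<integral>\<^sup>+v. indicator T (u, v) \<partial>lborel) \<partial>lborel)"
    proof -
      have inner: "(\<integral>\<^sup>+v. indicator S (y(i := u, j := v)) \<partial>uniform01) \<le> (\<integral>\<^sup>+v. indicator T (u, v) \<partial>lborel)" for u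
        unfolding nn_integral_uniform01
        by (rule nn_integral_mono) (use T(2) in \<open>auto simp: indicator_def\<close>)
      show ?thesis
        unfolding nn_integral_uniform01[of "\<lambda>u. \<integral>\<^sup>+v. indicator S (y(i := u, j := v)) \<partial>uniform01"]
        by (rule nn_integral_mono) (use inner in \<open>auto simp: indicator_def\<close>)
    qed
    also have "\<dots> = (\<integral>\<^sup>+p. indicator T p \<partial>lborel)"
      using T(1) by (subst lborel.nn_integral_fst) (auto simp: lborel_prod)
    finally show ?thesis using T by simp
  qed
  have S': "S \<in> sets (uniform_cube (insert j (insert i I)))" using S I by simp
  have "emeasure (uniform_cube J) S = (\<integral>\<^sup>+y. indicator S y \<partial>uniform_cube J)"
    using S by simp
  also have "\<dots> = (\<integral>\<^sup>+y. (\<integral>\<^sup>+v. indicator S (y(j := v)) \<partial>uniform01) \<partial>uniform_cube (insert i I))"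
    unfolding I(4) using S I by (intro cube.product_nn_integral_insert) auto
  also have "\<dots> = (\<integral>\<^sup>+y. (\<integral>\<^sup>+u. (\<integral>\<^sup>+v. indicator S (y(i := u, j := v)) \<partial>uniform01) \<partial>uniform01) \<partial>uniform_cube I)"
    using S' I by (intro cube.product_nn_integral_insert) auto
  also have "\<dots> \<le> (\<integral>\<^sup>+y. c \<partial>uniform_cube I)" by (intro nn_integral_mono *)
  also have "\<dots> = c" by (simp add: P.emeasure_space_1)
  finally show ?thesis .
qed

section \<open>Sublevel sets of polynomials with round quadratic part\<close>

text \<open>A polynomial with quadratic part a multiple of \<open>\<Sum>j. y\<^sub>j\<^sup>2\<close>, given by its coefficients. Up to a bounded
  positive factor, these are the restrictions of affine functions to a sphere in stereographic
  coordinates.\<close>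
definition round_quadratic :: "real \<Rightarrow> ('i \<Rightarrow> real) \<Rightarrow> real \<Rightarrow> 'i set \<Rightarrow> ('i \<Rightarrow> real) \<Rightarrow> real" where
  "round_quadratic A \<beta> B J y = A * (\<Sum>j\<in>J. (y j)\<^sup>2) + 2 * (\<Sum>j\<in>J. \<beta> j * y j) + B"

lemma round_quadratic_upd:
  assumes "finite J" "j \<in> J"
  shows "round_quadratic A \<beta> B J (y(j := u)) =
    A * u\<^sup>2 + 2 * \<beta> j * u + round_quadratic A \<beta> B (J - {j}) y"
  using assms by (simp add: round_quadratic_def sum.remove[of J j] algebra_simps)

lemma round_quadratic_measurable:
  "round_quadratic A \<beta> B J \<in> borel_measurable (uniform_cube J)"
  unfolding round_quadratic_def
  by (intro borel_measurable_add borel_measurable_times borel_measurable_const borel_measurable_sum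
      borel_measurable_power cube_coordinate_measurable)

lemma round_quadratic_sublevel_sets:
  "{y \<in> space (uniform_cube J). \<bar>round_quadratic A \<beta> B J y\<bar> \<le> t} \<in> sets (uniform_cube J)"
  by (intro borel_measurable_le borel_measurable_abs borel_measurable_const round_quadratic_measurable)

lemma space_uniform_cube: "y \<in> space (uniform_cube J) \<Longrightarrow> j \<in> J \<Longrightarrow> y j \<in> {0..1}"
  by (auto simp: space_PiM)

lemma complete_square:
  fixes A b c u t :: real
  assumes "A \<noteq> 0"
  shows "\<bar>A * u\<^sup>2 + 2 * b * u + c\<bar> \<le> t \<longleftrightarrow> \<bar>(u + b / A)\<^sup>2 - (b\<^sup>2 / A\<^sup>2 - c / A)\<bar> \<le> t / \<bar>A\<bar>"
proof -
  have "(u + b / A)\<^sup>2 - (b\<^sup>2 / A\<^sup>2 - c / A) = (A * u\<^sup>2 + 2 * b * u + c) / A"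
    using assms by (simp add: field_simps power2_eq_square)
  then show ?thesis using assms by (simp only: abs_divide divide_le_cancel) auto
qed

text \<open>After completing the square on a line parallel to an axis, a sublevel set becomes a thin shell.\<close>
lemma sublevel_curved_1:
  assumes J: "finite J" "J \<noteq> {}" and "A \<noteq> 0" "t \<ge> 0"
  shows "emeasure (uniform_cube J) {y \<in> space (uniform_cube J). \<bar>round_quadratic A \<beta> B J y\<bar> \<le> t}
    \<le> ennreal (2 * sqrt (2 * (t / \<bar>A\<bar>)))"
proof -
  obtain j where j: "j \<in> J" using J by blast
  show ?thesis
  proof (rule emeasure_uniform_cube_slice_le[OF J(1) j])
    fix y :: "'a \<Rightarrow> real"
    define c where "c = round_quadratic A \<beta> B (J - {j}) y"
    let ?T = "{u. \<bar>(u - (- \<beta> j / A))\<^sup>2 - ((\<beta> j)\<^sup>2 / A\<^sup>2 - c / A)\<bar> \<le> t / \<bar>A\<bar>}"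
    have "?T \<in> sets borel" by measurable
    moreover have "emeasure lborel ?T \<le> ennreal (2 * sqrt (2 * (t / \<bar>A\<bar>)))"
      by (rule emeasure_thin_shell_1_le) (use assms in simp)
    ultimately show "\<exists>T\<in>sets borel. (\<forall>u\<in>{0..1}. y(j := u) \<in>
        {y \<in> space (uniform_cube J). \<bar>round_quadratic A \<beta> B J y\<bar> \<le> t} \<longrightarrow> u \<in> T)
        \<and> emeasure lborel T \<le> ennreal (2 * sqrt (2 * (t / \<bar>A\<bar>)))"
      using complete_square[OF \<open>A \<noteq> 0\<close>, of _ "\<beta> j" c t]
      by (intro bexI[of _ ?T]) (auto simp: round_quadratic_upd[OF J(1) j] c_def)
  qed (rule round_quadratic_sublevel_sets)
qed

text \<open>On a plane parallel to two axes the quadratic part is still round, so sublevel sets become thin annuli.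
  This is where two coordinates are better than one.\<close>
lemma sublevel_curved_2:
  assumes J: "finite J" "card J \<ge> 2" and "A \<noteq> 0" "t \<ge> 0"
  shows "emeasure (uniform_cube J) {y \<in> space (uniform_cube J). \<bar>round_quadratic A \<beta> B J y\<bar> \<le> t}
    \<le> ennreal (2 * pi * (t / \<bar>A\<bar>))"
proof -
  obtain i j where ij: "i \<in> J" "j \<in> J" "i \<noteq> j"
    using J(2) card_le_Suc0_iff_eq[OF J(1)] by fastforce
  show ?thesis
  proof (rule emeasure_uniform_cube_slice2_le[OF J(1) ij])
    fix y :: "'a \<Rightarrow> real"
    define c where "c = round_quadratic A \<beta> B (J - {j} - {i}) y"
    let ?T = "{p::real \<times> real. \<bar>(norm (p - (- \<beta> i / A, - \<beta> j / A)))\<^sup>2 -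
       (((\<beta> i)\<^sup>2 + (\<beta> j)\<^sup>2) / A\<^sup>2 - c / A)\<bar> \<le> t / \<bar>A\<bar>}"
    have "?T \<in> sets borel" by measurable
    moreover have "emeasure lborel ?T \<le> ennreal (2 * pi * (t / \<bar>A\<bar>))"
      by (rule emeasure_thin_shell_2_le) (use assms in simp)
    moreover have "(u, v) \<in> ?T" if "\<bar>round_quadratic A \<beta> B J (y(i := u, j := v))\<bar> \<le> t" for u v
    proof -
      have "round_quadratic A \<beta> B J (y(i := u, j := v)) =
          A * v\<^sup>2 + 2 * \<beta> j * v + (A * u\<^sup>2 + 2 * \<beta> i * u + c)"
        using J ij by (simp add: round_quadratic_upd c_def)
      then have "\<bar>(v + \<beta> j / A)\<^sup>2 - ((\<beta> j)\<^sup>2 / A\<^sup>2 - (A * u\<^sup>2 + 2 * \<beta> i * u + c) / A)\<bar> \<le> t / \<bar>A\<bar>"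
        using that complete_square[OF \<open>A \<noteq> 0\<close>] by simp
      moreover have "(A * u\<^sup>2 + 2 * \<beta> i * u + c) / A = (u + \<beta> i / A)\<^sup>2 - (\<beta> i)\<^sup>2 / A\<^sup>2 + c / A"
        using \<open>A \<noteq> 0\<close> by (simp add: field_simps power2_eq_square)
      ultimately show ?thesis
        by (simp add: norm_Pair real_norm_def add_divide_distrib algebra_simps)
    qed
    ultimately show "\<exists>T\<in>sets borel. (\<forall>u v. y(i := u, j := v) \<in>
        {y \<in> space (uniform_cube J). \<bar>round_quadratic A \<beta> B J y\<bar> \<le> t} \<longrightarrow> (u, v) \<in> T)
        \<and> emeasure lborel T \<le> ennreal (2 * pi * (t / \<bar>A\<bar>))"
      by (intro bexI[of _ ?T] conjI allI impI) simp_all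
  qed (rule round_quadratic_sublevel_sets)
qed

text \<open>If a linear coefficient dominates the quadratic one, the derivative in that coordinate stays away from
  zero on \<open>{0..1}\<close>, and two points of a sublevel set on a line parallel to that axis are close.\<close>
lemma sublevel_transversal:
  assumes J: "finite J" "j \<in> J" and steep: "\<bar>A\<bar> \<le> \<bar>\<beta> j\<bar> / 2" "\<beta> j \<noteq> 0"
  shows "emeasure (uniform_cube J) {y \<in> space (uniform_cube J). \<bar>round_quadratic A \<beta> B J y\<bar> \<le> t}
    \<le> ennreal (4 * t / \<bar>\<beta> j\<bar>)"
proof (rule emeasure_uniform_cube_slice_le[OF J])
  fix y :: "'a \<Rightarrow> real"
  define c where "c = round_quadratic A \<beta> B (J - {j}) y"
  let ?T = "{u. 0 \<le> u \<and> u \<le> 1 \<and> \<bar>A * u\<^sup>2 + 2 * \<beta> j * u + c\<bar> \<le> t}"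
  have gap: "\<bar>u - v\<bar> \<le> 2 * t / \<bar>\<beta> j\<bar>" if "u \<in> ?T" "v \<in> ?T" for u v
  proof -
    have "\<bar>u + v\<bar> \<le> 2" using that by auto
    then have "\<bar>A * (u + v)\<bar> \<le> \<bar>\<beta> j\<bar> / 2 * 2"
      unfolding abs_mult using steep by (intro mult_mono) auto
    then have "\<bar>\<beta> j\<bar> \<le> \<bar>A * (u + v) + 2 * \<beta> j\<bar>" by linarith
    then have "\<bar>u - v\<bar> * \<bar>\<beta> j\<bar> \<le> \<bar>u - v\<bar> * \<bar>A * (u + v) + 2 * \<beta> j\<bar>"
      by (intro mult_left_mono) auto
    also have "\<dots> = \<bar>(A * u\<^sup>2 + 2 * \<beta> j * u + c) - (A * v\<^sup>2 + 2 * \<beta> j * v + c)\<bar>"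
      unfolding abs_mult[symmetric] by (simp add: algebra_simps power2_eq_square)
    also have "\<dots> \<le> 2 * t" using that by auto
    finally show ?thesis using steep by (simp add: field_simps)
  qed
  have "?T \<in> sets borel" by measurable
  moreover have "emeasure lborel ?T \<le> ennreal (4 * t / \<bar>\<beta> j\<bar>)"
    using emeasure_bounded_gaps_le[of ?T, OF gap] by (simp add: mult.assoc)
  ultimately show "\<exists>T\<in>sets borel. (\<forall>u\<in>{0..1}. y(j := u) \<in>
      {y \<in> space (uniform_cube J). \<bar>round_quadratic A \<beta> B J y\<bar> \<le> t} \<longrightarrow> u \<in> T)
      \<and> emeasure lborel T \<le> ennreal (4 * t / \<bar>\<beta> j\<bar>)"
    by (intro bexI[of _ ?T]) (auto simp: round_quadratic_upd[OF J] c_def)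
qed (rule round_quadratic_sublevel_sets)

text \<open>If the quadratic and all linear coefficients are small compared with the total size \<open>R\<close>, the constant
  term carries most of \<open>R\<close> and cannot be cancelled on the unit cube. The number \<open>\<delta>\<close> is chosen
  so that \<open>(7 * card J + 1) * \<delta> \<le> 7 / 8\<close>: all losses together are at most \<open>7 * R / 8\<close>.\<close>
lemma round_quadratic_constant_dominates:
  fixes \<beta> :: "'i \<Rightarrow> real"
  assumes J: "finite J" and y: "\<And>j. j \<in> J \<Longrightarrow> y j \<in> {0..1}"
    and R: "R = \<bar>A\<bar> + \<bar>B\<bar> + (\<Sum>j\<in>J. \<bar>\<beta> j\<bar>)" and \<delta>: "\<delta> = 1 / (8 * (real (card J) + 1))"
    and small: "\<bar>A\<bar> \<le> \<delta> * R" "\<And>j. j \<in> J \<Longrightarrow> \<bar>\<beta> j\<bar> \<le> 2 * \<delta> * R"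
  shows "R / 8 \<le> \<bar>round_quadratic A \<beta> B J y\<bar>"
proof -
  define N where "N = real (card J)"
  have "R \<ge> 0" by (simp add: R sum_nonneg)
  have sq: "0 \<le> (\<Sum>j\<in>J. (y j)\<^sup>2)" "(\<Sum>j\<in>J. (y j)\<^sup>2) \<le> N"
    using sum_bounded_above[of J "\<lambda>j. (y j)\<^sup>2" 1] y by (auto simp: N_def sum_nonneg power_le_one)
  have "\<bar>A * (\<Sum>j\<in>J. (y j)\<^sup>2)\<bar> \<le> \<delta> * R * N"
    unfolding abs_mult using sq small(1) by (intro mult_mono) auto
  moreover have \<beta>: "(\<Sum>j\<in>J. \<bar>\<beta> j\<bar>) \<le> N * (2 * \<delta> * R)"
    using sum_bounded_above[of J "\<lambda>j. \<bar>\<beta> j\<bar>"] small(2) by (simp add: N_def)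
  moreover have "\<bar>\<Sum>j\<in>J. \<beta> j * y j\<bar> \<le> (\<Sum>j\<in>J. \<bar>\<beta> j\<bar>)"
  proof (rule order_trans[OF sum_abs sum_mono])
    fix j assume "j \<in> J"
    with y[of j] show "\<bar>\<beta> j * y j\<bar> \<le> \<bar>\<beta> j\<bar>"
      by (simp add: abs_mult mult_left_le)
  qed
  moreover have "N * (2 * \<delta> * R) = 2 * (\<delta> * R * N)" "(7 * N + 1) * (\<delta> * R) = 7 * (\<delta> * R * N) + \<delta> * R"
    by (simp_all add: algebra_simps)
  ultimately have "\<bar>round_quadratic A \<beta> B J y\<bar> \<ge> R - (7 * N + 1) * (\<delta> * R)"
    using R small(1) unfolding round_quadratic_def by linarith
  moreover have "(7 * N + 1) * \<delta> \<le> 7 / 8"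
    by (simp add: \<delta> N_def field_simps)
  then have "(7 * N + 1) * \<delta> * R \<le> 7 / 8 * R" using \<open>R \<ge> 0\<close> by (rule mult_right_mono)
  ultimately show ?thesis by (simp add: mult.assoc)
qed

text \<open>The sublevel estimate behind the decay: it depends on the coefficients only through their total
  size \<open>R\<close>. A coefficient of size comparable to \<open>R\<close> must exist; a large quadratic coefficient gives thin
  shells, a large linear one gives transversality, and in the remaining case the constant term
  dominates and the sublevel set is empty unless \<open>t\<close> is comparable to \<open>R\<close>. Only shells on a line cost
  a square root.\<close>
theorem prob_round_quadratic_sublevel_le:
  fixes \<beta> :: "'i \<Rightarrow> real"
  assumes J: "finite J"
    and p: "0 < p" "p \<le> 1/2 \<and> 1 \<le> card J \<or> p \<le> 1 \<and> 2 \<le> card J"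
    and t: "0 < t" and R: "R = \<bar>A\<bar> + \<bar>B\<bar> + (\<Sum>j\<in>J. \<bar>\<beta> j\<bar>)" "0 < R"
  shows "measure (uniform_cube J) {y \<in> space (uniform_cube J). \<bar>round_quadratic A \<beta> B J y\<bar> \<le> t}
    \<le> 64 * (real (card J) + 1) * (t / R) powr p"
    (is "measure _ ?S \<le> ?N * _")
proof -
  interpret P: prob_space "uniform_cube J" by (intro prob_space_PiM prob_space_uniform01)
  define s where "s = t / R"
  have s: "s > 0" using t R by (simp add: s_def)
  define \<delta> where "\<delta> = 1 / (8 * (real (card J) + 1))"
  have \<delta>: "\<delta> > 0" by (simp add: \<delta>_def)
  have p1: "p \<le> 1" using p by auto
  have N: "?N = 8 / \<delta>" "?N \<ge> 64" by (auto simp: \<delta>_def)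
  show ?thesis
  proof (cases "s \<ge> 1")
    case True
    then have "1 \<le> s powr p" using p by (simp add: ge_one_powr_ge_zero)
    then have "1 * 1 \<le> ?N * s powr p" using N(2) by (intro mult_mono) auto
    then show ?thesis unfolding s_def mult_1 by (rule order_trans[OF P.prob_le_1])
  next
    case False
    have s_le: "s \<le> s powr p" using powr_mono'[of p 1 s] False s p1 by simp
    have *: "measure (uniform_cube J) ?S \<le> x" if "emeasure (uniform_cube J) ?S \<le> ennreal x" "x \<ge> 0" for x
      using that by (simp add: P.emeasure_eq_measure)
    consider "\<bar>A\<bar> \<ge> \<delta> * R" | j where "j \<in> J" "\<bar>A\<bar> < \<delta> * R" "\<bar>\<beta> j\<bar> \<ge> 2 * \<delta> * R"
      | "\<bar>A\<bar> < \<delta> * R" "\<And>j. j \<in> J \<Longrightarrow> \<bar>\<beta> j\<bar> < 2 * \<delta> * R"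
      by force
    then show ?thesis
    proof cases
      case 1
      have "0 < \<delta> * R" using \<delta> R by simp
      with 1 have A: "A \<noteq> 0" by auto
      have "t / \<bar>A\<bar> \<le> t / (\<delta> * R)"
        using 1 t A \<delta> R(2) by (intro divide_left_mono mult_pos_pos) simp_all
      then have tA: "t / \<bar>A\<bar> \<le> s / \<delta>" by (simp add: s_def mult.commute)
      show ?thesis
      proof (cases "p \<le> 1/2 \<and> 1 \<le> card J")
        case True
        then have "J \<noteq> {}" by auto
        have "measure (uniform_cube J) ?S \<le> 2 * sqrt (2 * (t / \<bar>A\<bar>))"
          using sublevel_curved_1[OF J \<open>J \<noteq> {}\<close> A] t by (intro *) auto
        also have "\<dots> \<le> 2 * sqrt (2 * (s / \<delta>))" using tA by simp
        also have "\<dots> = sqrt (4 * (2 * (s / \<delta>)))" by (simp only: real_sqrt_mult real_sqrt_four)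
        also have "\<dots> = sqrt ?N * sqrt s" unfolding N(1) real_sqrt_mult[symmetric] by simp
        also have "sqrt ?N \<le> ?N" using N(2) by (intro real_le_lsqrt) (auto simp: power2_eq_square)
        also have "sqrt s \<le> s powr p"
          using powr_mono'[of p "1/2" s] False s True by (simp add: powr_half_sqrt)
        finally show ?thesis using s by (simp add: s_def mult_right_mono mult_left_mono)
      next
        case False
        with p have "2 \<le> card J" by auto
        have "measure (uniform_cube J) ?S \<le> 2 * pi * (t / \<bar>A\<bar>)"
          using sublevel_curved_2[OF J \<open>2 \<le> card J\<close> A] t by (intro *) auto
        also have "\<dots> \<le> 8 * (s / \<delta>)" using tA pi_less_4 t by (intro mult_mono) auto
        also have "\<dots> = ?N * s" unfolding N(1) by simp
        also have "\<dots> \<le> ?N * s powr p" using s_le by (intro mult_left_mono) auto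
        finally show ?thesis by (simp add: s_def)
      qed
    next
      case 2
      have pos: "0 < 2 * \<delta> * R" using \<delta> R by simp
      have "measure (uniform_cube J) ?S \<le> 4 * t / \<bar>\<beta> j\<bar>"
        using sublevel_transversal[OF J 2(1), of A \<beta>] 2 pos t by (intro *) auto
      also have "\<dots> \<le> 4 * t / (2 * \<delta> * R)"
        using 2(3) t pos mult_pos_pos[of "\<bar>\<beta> j\<bar>" "2 * \<delta> * R"] by (intro divide_left_mono) linarith+
      also have "\<dots> = 2 / \<delta> * s" by (simp add: s_def)
      also have "\<dots> \<le> ?N * s powr p" unfolding N(1) using s_le \<delta> s by (intro mult_mono divide_right_mono) auto
      finally show ?thesis by (simp add: s_def)
    next
      case 3
      show ?thesis
      proof (cases "t < R / 8")
        case True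
        have "R / 8 \<le> \<bar>round_quadratic A \<beta> B J y\<bar>" if "y \<in> space (uniform_cube J)" for y
          using 3 space_uniform_cube[OF that]
          by (intro round_quadratic_constant_dominates[OF J _ R(1) \<delta>_def]) force+
        with True have empty: "?S = {}" by force
        show ?thesis unfolding empty by simp
      next
        case False
        then have "1 \<le> 8 * s" using R by (simp add: s_def field_simps)
        also have "\<dots> \<le> ?N * s powr p" using N(2) s_le s by (intro mult_mono) auto
        finally show ?thesis unfolding s_def mult_1 by (rule order_trans[OF P.prob_le_1])
      qed
    qed
  qed
qed

section \<open>Fourier transforms of segments and tail integration\<close>

text \<open>The Fourier transform of the uniform law on a segment decays like the inverse of the frequency \<open>w\<close>
  along the segment, since the phase has the primitive with the factor \<open>1 / (2 * pi * w)\<close>. Multiplying by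
  the frequency covers \<open>w = 0\<close> as well.\<close>
lemma segment_phase_integral_le:
  fixes w c :: real
  shows "\<bar>w\<bar> * norm (LINT r|uniform01. exp (- 2 * of_real pi * \<i> * of_real (c + r * w))) \<le> 1"
proof (cases "w = 0")
  case False
  define k where "k = - 2 * of_real pi * \<i> * complex_of_real w"
  have k: "k \<noteq> 0" "norm k = 2 * pi * \<bar>w\<bar>" using False by (auto simp: k_def norm_mult)
  define e where "e r = exp (- 2 * of_real pi * \<i> * complex_of_real (c + r * w))" for r
  have norm_e: "norm (e r) = 1" for r
    using norm_exp_i_times[of "- 2 * pi * (c + r * w)"] by (simp add: e_def mult_ac)
  have "(LINT r|uniform01. e r) = (LINT r|lborel. indicator {0..1} r *\<^sub>R e r)"
    unfolding uniform01_def by (subst integral_restrict_space) auto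
  also have "\<dots> = e 1 / k - e 0 / k"
  proof (rule integral_FTC_Icc)
    show "((\<lambda>r. e r / k) has_vector_derivative e r) (at r within {0..1})" for r
    proof -
      have "((\<lambda>z. exp (- 2 * of_real pi * \<i> * (of_real c + z * of_real w)) / k) has_field_derivative e r)
        (at (of_real r))"
        using k(1) by (auto intro!: derivative_eq_intros simp: e_def) (simp add: k_def mult_ac)
      from has_vector_derivative_real_field[OF this] show ?thesis by (simp add: e_def)
    qed
  qed (auto simp: e_def intro!: continuous_intros)
  finally have "norm (LINT r|uniform01. e r) \<le> norm (e 1 / k) + norm (e 0 / k)"
    by (simp add: norm_triangle_ineq4)
  also have "\<dots> = 1 / (pi * \<bar>w\<bar>)" by (simp add: norm_divide norm_e k(2))
  finally have "\<bar>w\<bar> * norm (LINT r|uniform01. e r) \<le> \<bar>w\<bar> * (1 / (pi * \<bar>w\<bar>))"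
    by (intro mult_left_mono) auto
  also have "\<dots> \<le> 1" using False pi_ge_two by (simp add: field_simps)
  finally show ?thesis by (simp add: e_def)
qed simp

text \<open>The layer cake formula: integrate the tail bound over the levels \<open>v\<close> in \<open>{0..1}\<close>.\<close>
lemma (in prob_space) expectation_le_of_tail:
  fixes F :: "'a \<Rightarrow> real"
  assumes [measurable]: "F \<in> borel_measurable M"
    and F: "\<And>x. x \<in> space M \<Longrightarrow> 0 \<le> F x" "\<And>x. x \<in> space M \<Longrightarrow> F x \<le> 1"
    and p: "p < 1" and C: "0 \<le> C"
    and tail: "\<And>v. 0 < v \<Longrightarrow> v \<le> 1 \<Longrightarrow> prob {x \<in> space M. v \<le> F x} \<le> C * v powr - p"
  shows "expectation F \<le> C / (1 - p)"
proof -
  interpret pair_sigma_finite M lborel ..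
  have meas: "(\<lambda>(x, v). if 0 < v \<and> v \<le> F x then 1 else 0 :: ennreal) \<in> borel_measurable (M \<Otimes>\<^sub>M lborel)"
  proof -
    have "(\<lambda>z. F (fst z)) \<in> borel_measurable (M \<Otimes>\<^sub>M lborel)" by (rule measurable_compose[OF measurable_fst]) fact
    moreover have "(\<lambda>z. snd z) \<in> borel_measurable (M \<Otimes>\<^sub>M lborel)"
      using measurable_snd[of M lborel] by simp
    ultimately have "{z \<in> space (M \<Otimes>\<^sub>M lborel). 0 < snd z \<and> snd z \<le> F (fst z)} \<in> sets (M \<Otimes>\<^sub>M lborel)"
      by (intro sets.sets_Collect_conj borel_measurable_le borel_measurable_less borel_measurable_const)
    then show ?thesis
      unfolding case_prod_beta by (intro measurable_If borel_measurable_const)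
  qed
  have "(\<integral>\<^sup>+x. ennreal (F x) \<partial>M) = (\<integral>\<^sup>+x. (\<integral>\<^sup>+v. (if 0 < v \<and> v \<le> F x then 1 else 0) \<partial>lborel) \<partial>M)"
  proof (rule nn_integral_cong)
    fix x assume x: "x \<in> space M"
    have "(\<integral>\<^sup>+v. (if 0 < v \<and> v \<le> F x then 1 else 0) \<partial>lborel) = (\<integral>\<^sup>+v. indicator {0<..F x} v \<partial>lborel)"
      by (intro nn_integral_cong) (auto simp: indicator_def)
    also have "\<dots> = ennreal (F x)" using F(1)[OF x] by simp
    finally show "ennreal (F x) = (\<integral>\<^sup>+v. (if 0 < v \<and> v \<le> F x then 1 else 0) \<partial>lborel)" ..
  qed
  also have "\<dots> = (\<integral>\<^sup>+v. (\<integral>\<^sup>+x. (if 0 < v \<and> v \<le> F x then 1 else 0) \<partial>M) \<partial>lborel)"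
    using Fubini'[OF meas] by (rule sym)
  also have "\<dots> \<le> (\<integral>\<^sup>+v. ennreal (C * v powr - p) * indicator {0..1} v \<partial>lborel)"
  proof (rule nn_integral_mono)
    fix v :: real
    have "(\<integral>\<^sup>+x. (if 0 < v \<and> v \<le> F x then 1 else 0) \<partial>M) =
        (\<integral>\<^sup>+x. indicator {x \<in> space M. 0 < v \<and> v \<le> F x} x \<partial>M)"
      by (intro nn_integral_cong) (auto simp: indicator_def)
    also have "\<dots> = emeasure M {x \<in> space M. 0 < v \<and> v \<le> F x}" by simp
    also have "\<dots> \<le> ennreal (C * v powr - p) * indicator {0..1} v"
    proof (cases "0 < v \<and> v \<le> 1")
      case True
      with tail[of v] show ?thesis by (simp add: emeasure_eq_measure ennreal_leI)
    next
      case False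
      then have empty: "{x \<in> space M. 0 < v \<and> v \<le> F x} = {}"
        using F(2) by fastforce
      show ?thesis unfolding empty by simp
    qed
    finally show "(\<integral>\<^sup>+x. (if 0 < v \<and> v \<le> F x then 1 else 0) \<partial>M)
      \<le> ennreal (C * v powr - p) * indicator {0..1} v" .
  qed
  also have "\<dots> = ennreal (C / (1 - p))"
  proof (rule nn_integral_has_integral_lebesgue')
    have "((\<lambda>v. C * v powr - p) has_integral (C * (1 powr (- p + 1) / (- p + 1)))) {0..1}"
      using p by (intro has_integral_mult_right has_integral_powr_from_0) auto
    then show "((\<lambda>v. C * v powr - p) has_integral (C / (1 - p))) {0..1}" by simp
  qed (use C in auto)
  finally have "(\<integral>\<^sup>+x. ennreal (F x) \<partial>M) \<le> ennreal (C / (1 - p))" .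
  moreover have "integrable M F"
    using F by (intro integrable_const_bound[of _ 1] AE_I2) auto
  ultimately show ?thesis
    using F C p by (subst (asm) nn_integral_eq_integral) (auto intro!: AE_I2 simp: ennreal_le_iff)
qed

section \<open>Stereographic coordinates on a non-degenerate sphere\<close>

text \<open>A sphere of codimension two inside the unit sphere is a full hyperplane slice of it. Comparing the norms
  of \<open>c + v\<close> and \<open>c - v\<close>, for \<open>v\<close> parallel to the hyperplane, shows that the centre \<open>c\<close> is orthogonal to all
  such \<open>v\<close>, hence a multiple \<open>a\<close> of the unit normal, and that the radius is the one of the slice. If \<open>a\<close> were
  zero, the sphere would contain antipodal points and have diameter \<open>2\<close>.\<close>
lemma nondegenerate_sphere_contains_slice:
  fixes \<Gamma> :: "(real ^ 'n) set"
  assumes d: "CARD('n) \<ge> 2" and \<Gamma>: "nondegenerate_sphere \<Gamma>"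
  obtains e a where "norm e = 1" "0 < \<bar>a\<bar>" "\<bar>a\<bar> < 1" "\<And>x. norm x = 1 \<Longrightarrow> x \<bullet> e = a \<Longrightarrow> x \<in> \<Gamma>"
proof -
  from \<Gamma> obtain A c \<rho> where A: "affine A" "aff_dim A = int CARD('n) - 2 + 1" "c \<in> A" and \<rho>: "\<rho> > 0"
    and \<Gamma>_eq: "\<Gamma> = A \<inter> sphere c \<rho>" and unit: "\<Gamma> \<subseteq> sphere 0 1" and diam: "diameter \<Gamma> < 2"
    unfolding nondegenerate_sphere_def k_sphere_def by blast
  have "aff_dim A = DIM(real ^ 'n) - 1" using A(2) d by simp
  then obtain n b where n: "n \<noteq> 0" "A = {x. n \<bullet> x = b}"
    unfolding aff_dim_eq_hyperplane affine_hull_eq[THEN iffD2, OF A(1)] by blast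
  define e where "e = n /\<^sub>R norm n"
  have e: "norm e = 1" using n by (simp add: e_def)
  have A_eq: "x \<in> A \<longleftrightarrow> (x - c) \<bullet> e = 0" for x
    using n A(3) by (auto simp: e_def inner_diff_right inner_commute[of _ n] inner_diff_left)
  have on: "c + v \<in> \<Gamma>" if "v \<bullet> e = 0" "norm v = \<rho>" for v
    using that A_eq[of "c + v"] by (auto simp: \<Gamma>_eq dist_norm)
  have orth: "c \<bullet> v = 0 \<and> (norm c)\<^sup>2 + \<rho>\<^sup>2 = 1" if v: "v \<bullet> e = 0" "norm v = \<rho>" for v
  proof -
    have "norm (c + v) = 1" "norm (c + (- v)) = 1"
      using on[OF v] on[of "- v"] v unit by auto
    then show ?thesis
      using v dot_norm[of c v] dot_norm_neg[of c v] by simp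
  qed
  define a where "a = c \<bullet> e"
  define w where "w = c - a *\<^sub>R e"
  have we: "w \<bullet> e = 0" using e by (simp add: w_def a_def inner_simps dot_square_norm)
  have "w = 0"
  proof (rule ccontr)
    assume "w \<noteq> 0"
    then have "c \<bullet> ((\<rho> / norm w) *\<^sub>R w) = 0"
      using we \<rho> by (intro orth[THEN conjunct1]) auto
    then have "c \<bullet> w = 0" using \<rho> \<open>w \<noteq> 0\<close> by simp
    moreover have "c \<bullet> w = w \<bullet> w + a * (w \<bullet> e)" by (simp add: w_def inner_simps inner_commute algebra_simps)
    ultimately show False using we \<open>w \<noteq> 0\<close> by simp
  qed
  then have c: "c = a *\<^sub>R e" by (simp add: w_def)
  obtain v0 where v0: "v0 \<noteq> 0" "orthogonal e v0"
    using orthogonal_to_vector_exists[of e] d by auto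
  define v where "v = (\<rho> / norm v0) *\<^sub>R v0"
  have v: "v \<bullet> e = 0" "norm v = \<rho>"
    using v0 \<rho> by (auto simp: v_def orthogonal_def inner_commute)
  have a\<rho>: "a\<^sup>2 + \<rho>\<^sup>2 = 1" using orth[OF v] e by (simp add: c)
  have "a \<noteq> 0"
  proof
    assume "a = 0"
    with a\<rho> \<rho> have "\<rho> = 1" by (simp add: power2_eq_1_iff)
    have "v \<in> \<Gamma>" "- v \<in> \<Gamma>" using on[OF v] on[of "- v"] v \<open>a = 0\<close> by (auto simp: c)
    moreover have "bounded \<Gamma>" using unit bounded_subset bounded_sphere by blast
    ultimately have "dist v (- v) \<le> diameter \<Gamma>" by (intro diameter_bounded_bound)
    moreover have "dist v (- v) = norm (2 *\<^sub>R v)" by (simp add: dist_norm scaleR_2)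
    ultimately show False using diam v \<open>\<rho> = 1\<close> by simp
  qed
  have "a\<^sup>2 < 1" using a\<rho> \<rho> by (smt (verit) zero_less_power)
  then have "\<bar>a\<bar> < 1" by (simp add: abs_square_less_1)
  moreover have "x \<in> \<Gamma>" if x: "norm x = 1" "x \<bullet> e = a" for x
  proof -
    have xe: "(x - c) \<bullet> e = 0" using x e by (simp add: c inner_simps dot_square_norm)
    have "(norm (x - c))\<^sup>2 = 1 - a\<^sup>2"
      using x e dot_norm_neg[of x "a *\<^sub>R e"] by (simp add: c power2_eq_square)
    then have "(norm (x - c))\<^sup>2 = \<rho>\<^sup>2" using a\<rho> by linarith
    then have "norm (x - c) = \<rho>" by (rule power2_eq_imp_eq) (use \<rho> in auto)
    with on[OF xe] show ?thesis by simp
  qed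
  ultimately show thesis using that e \<open>a \<noteq> 0\<close> by auto
qed

text \<open>Inverse stereographic projection onto the slice of the unit sphere at height \<open>a\<close> over the
  hyperplane orthogonal to the axis \<open>i0\<close>. The pole lies in the direction of \<open>i1\<close>, and the remaining
  coordinates of \<open>y\<close> are the parameters.\<close>
definition stereographic :: "'n \<Rightarrow> 'n \<Rightarrow> real \<Rightarrow> ('n \<Rightarrow> real) \<Rightarrow> real ^ 'n" where
  "stereographic i0 i1 a y = (let q = (\<Sum>j\<in>- {i0, i1}. (y j)\<^sup>2) in
     \<chi> i. if i = i0 then a else sqrt (1 - a\<^sup>2) * (if i = i1 then (1 - q) / (1 + q) else 2 * y i / (1 + q)))"

lemma sum_UNIV_split2:
  fixes i0 i1 :: "'n::finite"
  assumes "i0 \<noteq> i1"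
  shows "(\<Sum>i\<in>UNIV. f i) = f i0 + f i1 + (\<Sum>j\<in>- {i0, i1}. f j)"
proof -
  have "UNIV = insert i0 (insert i1 (- {i0, i1}))" by auto
  then have "(\<Sum>i\<in>UNIV. f i) = (\<Sum>i\<in>insert i0 (insert i1 (- {i0, i1})). f i)" by simp
  also have "\<dots> = f i0 + f i1 + (\<Sum>j\<in>- {i0, i1}. f j)"
    using assms by (subst sum.insert; simp add: add.assoc)
  finally show ?thesis .
qed

lemma norm_stereographic:
  assumes i: "i0 \<noteq> i1" and a: "\<bar>a\<bar> < 1"
  shows "norm (stereographic i0 i1 a y :: real ^ 'n) = 1"
proof -
  define q where "q = (\<Sum>j\<in>- {i0, i1}. (y j)\<^sup>2)"
  have q: "0 \<le> q" by (simp add: q_def sum_nonneg)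
  have a2: "0 \<le> 1 - a\<^sup>2" using a by (simp add: abs_square_le_1)
  let ?x = "stereographic i0 i1 a y"
  have "(\<Sum>i\<in>UNIV. (?x $ i)\<^sup>2) = a\<^sup>2 + (1 - a\<^sup>2) * ((1 - q) / (1 + q))\<^sup>2 +
      (\<Sum>j\<in>- {i0, i1}. (1 - a\<^sup>2) * (4 / (1 + q)\<^sup>2) * (y j)\<^sup>2)"
    unfolding sum_UNIV_split2[OF i]
    using i a2 by (auto simp: stereographic_def Let_def q_def[symmetric] power_mult_distrib power_divide
       intro!: sum.cong)
  also have "\<dots> = a\<^sup>2 + (1 - a\<^sup>2) * ((1 - q) / (1 + q))\<^sup>2 + (1 - a\<^sup>2) * (4 / (1 + q)\<^sup>2) * q"
    unfolding q_def by (simp only: sum_distrib_left)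
  also have "\<dots> = a\<^sup>2 + (1 - a\<^sup>2) * (((1 - q)\<^sup>2 + 4 * q) / (1 + q)\<^sup>2)"
    by (simp add: power_divide add_divide_distrib distrib_left)
  also have "(1 - q)\<^sup>2 + 4 * q = (1 + q)\<^sup>2" by (simp add: power2_eq_square algebra_simps)
  finally show ?thesis using q by (simp add: norm_vec_def L2_set_def)
qed

text \<open>In stereographic coordinates the frequency along a segment is, up to the factor \<open>1 + \<bar>y\<bar>\<^sup>2\<close>, a
  polynomial with round quadratic part.\<close>
lemma inner_stereographic:
  fixes \<eta> :: "real ^ 'n"
  assumes i: "i0 \<noteq> i1"
  defines "\<rho> \<equiv> \<lambda>a. sqrt (1 - a\<^sup>2)" and "J \<equiv> - {i0, i1}"
  shows "(\<eta> \<bullet> stereographic i0 i1 a y) * (1 + (\<Sum>j\<in>J. (y j)\<^sup>2)) =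
    round_quadratic (a * \<eta> $ i0 - \<rho> a * \<eta> $ i1) (\<lambda>j. \<rho> a * \<eta> $ j) (a * \<eta> $ i0 + \<rho> a * \<eta> $ i1) J y"
proof -
  define q where "q = (\<Sum>j\<in>J. (y j)\<^sup>2)"
  have "0 \<le> q" by (simp add: q_def sum_nonneg)
  then have q: "1 + q \<noteq> 0" by simp
  let ?x = "stereographic i0 i1 a y"
  have x: "?x $ i0 = a" "?x $ i1 = \<rho> a * ((1 - q) / (1 + q))"
    "\<And>j. j \<in> J \<Longrightarrow> ?x $ j = \<rho> a * (2 * y j / (1 + q))"
    using i by (auto simp: stereographic_def Let_def q_def J_def \<rho>_def)
  have "\<eta> \<bullet> ?x = \<eta> $ i0 * a + \<eta> $ i1 * (\<rho> a * ((1 - q) / (1 + q))) +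
      (\<Sum>j\<in>J. \<eta> $ j * (\<rho> a * (2 * y j / (1 + q))))"
    unfolding inner_vec_def sum_UNIV_split2[OF i] J_def[symmetric] by (simp add: x)
  also have "(\<Sum>j\<in>J. \<eta> $ j * (\<rho> a * (2 * y j / (1 + q)))) = 2 / (1 + q) * (\<Sum>j\<in>J. \<rho> a * \<eta> $ j * y j)"
    by (simp add: sum_distrib_left mult_ac)
  finally show ?thesis
    unfolding round_quadratic_def q_def[symmetric] using q
    by (simp add: distrib_right mult.assoc) (simp add: algebra_simps)
qed

text \<open>The coefficients see the whole vector \<open>\<eta>\<close>. The component along \<open>i0\<close> enters with the factor \<open>a\<close>, so
  this is the place where the non-degeneracy \<open>a \<noteq> 0\<close> is indispensable: a sphere in a hyperplane through
  the origin gives no information about frequencies normal to that hyperplane.\<close>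
lemma stereographic_coefficients_ge:
  fixes \<eta> :: "real ^ 'n"
  assumes i: "i0 \<noteq> i1" and m: "0 \<le> m" "m \<le> \<bar>a\<bar>" "m \<le> \<rho>"
  shows "m * norm \<eta> \<le> \<bar>a * \<eta> $ i0 - \<rho> * \<eta> $ i1\<bar> + \<bar>a * \<eta> $ i0 + \<rho> * \<eta> $ i1\<bar> +
    (\<Sum>j\<in>- {i0, i1}. \<bar>\<rho> * \<eta> $ j\<bar>)"
proof -
  have \<rho>: "m * \<bar>\<eta> $ j\<bar> \<le> \<bar>\<rho> * \<eta> $ j\<bar>" for j
    unfolding abs_mult using m by (intro mult_right_mono) auto
  have "m * norm \<eta> \<le> m * (\<Sum>i\<in>UNIV. \<bar>\<eta> $ i\<bar>)"
    using norm_le_l1_cart[of \<eta>] m by (intro mult_left_mono) auto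
  also have "\<dots> = m * \<bar>\<eta> $ i0\<bar> + m * \<bar>\<eta> $ i1\<bar> + (\<Sum>j\<in>- {i0, i1}. m * \<bar>\<eta> $ j\<bar>)"
    unfolding sum_UNIV_split2[OF i] by (simp add: distrib_left sum_distrib_left)
  also have "\<dots> \<le> \<bar>a * \<eta> $ i0\<bar> + \<bar>\<rho> * \<eta> $ i1\<bar> + (\<Sum>j\<in>- {i0, i1}. \<bar>\<rho> * \<eta> $ j\<bar>)"
    using m by (intro add_mono sum_mono \<rho>) (auto simp: abs_mult intro: mult_right_mono)
  also have "\<bar>a * \<eta> $ i0\<bar> + \<bar>\<rho> * \<eta> $ i1\<bar> \<le>
      \<bar>a * \<eta> $ i0 - \<rho> * \<eta> $ i1\<bar> + \<bar>a * \<eta> $ i0 + \<rho> * \<eta> $ i1\<bar>" by linarith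
  finally show ?thesis by simp
qed

lemma stereographic_measurable:
  "stereographic i0 i1 a \<in> borel_measurable (uniform_cube (- {i0, i1}))"
proof -
  let ?J = "- {i0, i1}"
  have q: "(\<lambda>y. \<Sum>j\<in>?J. (y j)\<^sup>2) \<in> borel_measurable (uniform_cube ?J)"
    by (intro borel_measurable_sum borel_measurable_power cube_coordinate_measurable)
  have "(\<lambda>y. stereographic i0 i1 a y $ i) \<in> borel_measurable (uniform_cube ?J)" for i
  proof -
    consider "i \<in> ?J" | "i = i0" | "i = i1" "i1 \<noteq> i0" by auto
    then show ?thesis
    proof cases
      case 1
      then show ?thesis
        using q cube_coordinate_measurable[OF 1] by (simp add: stereographic_def Let_def)
    qed (use q in \<open>simp_all add: stereographic_def Let_def\<close>)
  qed
  then show ?thesis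
    by (subst borel_measurable_euclidean_space) (auto simp: Basis_vec_def cart_eq_inner_axis[symmetric])
qed

section \<open>Fourier decay of a measure on segments\<close>

text \<open>The admissible starting points of a segment in a given direction form a compact set, and the pairs of
  direction and admissible starting point in a closed set form a compact set as well. Its projection is
  compact, hence Borel, and the measurable selection theorem applies.\<close>
lemma measurable_segment_choice:
  fixes E :: "'a::euclidean_space set"
  assumes E: "compact E" and S: "compact S"
    and seg: "\<And>\<theta>. \<theta> \<in> S \<Longrightarrow> \<exists>t. \<forall>r\<in>{0..1::real}. t + r *\<^sub>R \<theta> \<in> E"
  obtains \<tau> where "\<tau> \<in> borel_measurable (restrict_space borel S)"
    "\<And>\<theta> r. \<theta> \<in> S \<Longrightarrow> r \<in> {0..1::real} \<Longrightarrow> \<tau> \<theta> + r *\<^sub>R \<theta> \<in> E"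
proof -
  define K where "K \<theta> = {t. \<forall>r\<in>{0..1::real}. t + r *\<^sub>R \<theta> \<in> E}" for \<theta>
  have cl: "closed E" using E by (rule compact_imp_closed)
  have KE: "K \<theta> \<subseteq> E" for \<theta> by (force simp: K_def)
  have "compact (K \<theta>)" for \<theta>
  proof -
    have "K \<theta> = (\<Inter>r\<in>{0..1}. (\<lambda>t. t + r *\<^sub>R \<theta>) -` E)" by (auto simp: K_def)
    also have "closed \<dots>"
      by (intro closed_INT ballI continuous_closed_vimage[OF cl]) (auto intro!: continuous_intros)
    finally show ?thesis using KE[of \<theta>] E by (metis compact_Int_closed inf.absorb_iff2)
  qed
  moreover have "K \<theta> \<noteq> {}" if "\<theta> \<in> S" for \<theta> using seg[OF that] by (auto simp: K_def)
  moreover have "weakly_measurable_on (restrict_space borel S) K"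
    unfolding weakly_measurable_on_def
  proof (intro allI impI)
    fix C :: "'a set" assume C: "closed C"
    \<comment> \<open>Intersecting with \<open>E\<close> loses nothing, as \<open>r = 0\<close> puts the starting point into \<open>E\<close>; it makes \<open>?Z\<close> compact.\<close>
    let ?Z = "(S \<times> (E \<inter> C)) \<inter> (\<Inter>r\<in>{0..1::real}. (\<lambda>p. snd p + r *\<^sub>R fst p) -` E)"
    have "closed (\<Inter>r\<in>{0..1::real}. (\<lambda>p. snd p + r *\<^sub>R fst p) -` E)"
      by (intro closed_INT ballI continuous_closed_vimage[OF cl]) (auto intro!: continuous_intros)
    then have "compact ?Z"
      using E S C by (intro compact_Int_closed compact_Times)
    then have "compact (fst ` ?Z)"
      by (intro compact_continuous_image) (auto intro!: continuous_intros)
    moreover have "fst ` ?Z = {\<theta> \<in> S. K \<theta> \<inter> C \<noteq> {}}"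
    proof (intro set_eqI iffI)
      fix \<theta> assume "\<theta> \<in> {\<theta> \<in> S. K \<theta> \<inter> C \<noteq> {}}"
      then obtain t where t: "\<theta> \<in> S" "t \<in> K \<theta>" "t \<in> C" by auto
      then have "(\<theta>, t) \<in> ?Z" using KE by (auto simp: K_def)
      then show "\<theta> \<in> fst ` ?Z" by (rule image_eqI[rotated]) simp
    qed (auto simp: K_def)
    ultimately have "compact {\<theta> \<in> S. K \<theta> \<inter> C \<noteq> {}}" by simp
    then show "{\<theta> \<in> space (restrict_space borel S). K \<theta> \<inter> C \<noteq> {}} \<in> sets (restrict_space borel S)"
      using borel_compact[OF S] borel_compact[of "{\<theta> \<in> S. K \<theta> \<inter> C \<noteq> {}}"]
      by (subst sets_restrict_space_iff) (auto simp: space_restrict_space)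
  qed
  ultimately obtain \<tau> where "\<tau> \<in> borel_measurable (restrict_space borel S)"
    "\<And>\<theta>. \<theta> \<in> S \<Longrightarrow> \<tau> \<theta> \<in> K \<theta>"
    using compact_valued_measurable_selection[of "restrict_space borel S" K]
    by (auto simp: space_restrict_space)
  then show thesis using that by (auto simp: K_def)
qed

text \<open>The measure is the law of a uniform point on the chosen segment in a random direction. Its Fourier
  transform at \<open>\<xi>\<close> is an average over directions of Fourier transforms of segments, where the choice of the
  starting points only contributes phases of modulus one. The modulus \<open>F y\<close> of the contribution of a
  direction is at least \<open>v\<close> only if the frequency along that direction is at most \<open>1 / v\<close>, and the sublevel
  estimate bounds the probability of this event by a multiple of \<open>(v * norm \<xi>) powr - p\<close>. Integrating over
  \<open>v\<close> needs \<open>p < 1\<close>.\<close>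
theorem segment_measure_fourier_decay:
  fixes E :: "(real ^ 'n) set" and \<Gamma> :: "(real ^ 'n) set"
  assumes d: "CARD('n) \<ge> 3" and E: "compact E"
    and \<Gamma>: "nondegenerate_sphere \<Gamma>" "contains_unit_segment_in_directions E \<Gamma>"
    and p: "0 < p" "p < 1" "p \<le> 1/2 \<or> CARD('n) \<ge> 4"
  shows "\<exists>M C. borel_prob_on E M \<and> C > 0 \<and>
    (\<forall>\<xi>. \<xi> \<noteq> 0 \<longrightarrow> norm (fourier_transform M \<xi>) \<le> C * norm \<xi> powr - p)"
proof -
  obtain e a where e: "norm e = 1" and a: "0 < \<bar>a\<bar>" "\<bar>a\<bar> < 1"
    and slice: "\<And>x. norm x = 1 \<Longrightarrow> x \<bullet> e = a \<Longrightarrow> x \<in> \<Gamma>"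
    by (rule nondegenerate_sphere_contains_slice[OF _ \<Gamma>(1)]) (use d in auto)
  obtain i0 i1 :: 'n where i: "i0 \<noteq> i1"
    using d card_le_Suc0_iff_eq[of "UNIV :: 'n set"] by fastforce
  define J where "J = - {i0, i1}"
  have J: "finite J" "card J = CARD('n) - 2" using i by (auto simp: J_def Compl_eq_Diff_UNIV card_Diff_subset)
  define D where "D = real (card J) + 1"
  have D: "D > 0" by (simp add: D_def)
  \<comment> \<open>Rotating the frequency instead of the sphere moves the normal of the slice to a coordinate axis.\<close>
  obtain T :: "real ^ 'n \<Rightarrow> real ^ 'n" where T: "orthogonal_transformation T" "T (axis i0 1) = e"
    using orthogonal_transformation_exists[of "axis i0 1 :: real ^ 'n" e] e by auto
  have T_inner: "T u \<bullet> T v = u \<bullet> v" for u v using T(1) by (simp add: orthogonal_transformation_def)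
  define S where "S = {x :: real ^ 'n. norm x = 1 \<and> x \<bullet> e = a}"
  have "compact S"
  proof -
    have "S = sphere 0 1 \<inter> {x. x \<bullet> e = a}" by (auto simp: S_def)
    moreover have "closed {x. x \<bullet> e = a}" by (intro closed_Collect_eq continuous_intros)
    ultimately show ?thesis by (simp add: compact_Int_closed)
  qed
  moreover have "\<exists>t. \<forall>r\<in>{0..1::real}. t + r *\<^sub>R \<theta> \<in> E" if "\<theta> \<in> S" for \<theta>
    using that slice \<Gamma>(2) by (auto simp: S_def contains_unit_segment_in_directions_def)
  ultimately obtain \<tau> where \<tau>: "\<tau> \<in> borel_measurable (restrict_space borel S)"
    and \<tau>_E: "\<And>\<theta> r. \<theta> \<in> S \<Longrightarrow> r \<in> {0..1::real} \<Longrightarrow> \<tau> \<theta> + r *\<^sub>R \<theta> \<in> E"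
    using measurable_segment_choice[OF E] by blast
  define \<theta> where "\<theta> y = T (stereographic i0 i1 a y)" for y
  have \<theta>_S: "\<theta> y \<in> S" for y
  proof -
    have "norm (\<theta> y) = 1"
      using norm_stereographic[OF i a(2)] orthogonal_transformation_norm[OF T(1)] by (simp add: \<theta>_def)
    moreover have "\<theta> y \<bullet> e = stereographic i0 i1 a y $ i0"
      unfolding \<theta>_def T(2)[symmetric] T_inner by (simp add: inner_axis)
    ultimately show ?thesis by (simp add: S_def stereographic_def Let_def)
  qed
  have "continuous_on UNIV T"
    using orthogonal_transformation_linear[OF T(1)] by (simp add: linear_continuous_on linear_linear)
  then have \<theta>_meas: "\<theta> \<in> borel_measurable (uniform_cube J)"
    unfolding \<theta>_def J_def
    by (intro measurable_compose[OF stereographic_measurable] borel_measurable_continuous_onI)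
  have \<tau>_meas: "(\<lambda>y. \<tau> (\<theta> y)) \<in> borel_measurable (uniform_cube J)"
    by (rule measurable_compose[OF measurable_restrict_space2[OF _ \<theta>_meas] \<tau>]) (use \<theta>_S in auto)

  interpret Y: prob_space "uniform_cube J" by (intro prob_space_PiM prob_space_uniform01)
  interpret YR: pair_prob_space "uniform_cube J" uniform01 ..
  define g where "g z = \<tau> (\<theta> (fst z)) + snd z *\<^sub>R \<theta> (fst z)" for z
  have snd_meas: "snd \<in> borel_measurable (uniform_cube J \<Otimes>\<^sub>M uniform01)"
    by (rule measurable_compose[OF measurable_snd uniform01_id_measurable])
  have g_meas: "g \<in> borel_measurable (uniform_cube J \<Otimes>\<^sub>M uniform01)"
    unfolding g_def
    by (intro borel_measurable_add borel_measurable_scaleR snd_meas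
        measurable_compose[OF measurable_fst \<tau>_meas] measurable_compose[OF measurable_fst \<theta>_meas])
  \<comment> \<open>The first component of a sample point selects the direction, the second the position on its segment.\<close>
  define M where "M = distr (uniform_cube J \<Otimes>\<^sub>M uniform01) borel g"
  have "borel_prob_on E M"
    unfolding borel_prob_on_def
  proof (intro conjI)
    show "prob_space M" unfolding M_def by (rule YR.prob_space_distr[OF g_meas])
    show "sets M = sets borel" by (simp add: M_def)
    have empty: "g -` (- E) \<inter> space (uniform_cube J \<Otimes>\<^sub>M uniform01) = {}"
      using \<tau>_E[OF \<theta>_S] by (auto simp: g_def space_pair_measure)
    have "- E \<in> sets borel" using borel_compact[OF E] by simp
    then show "emeasure M (- E) = 0" unfolding M_def by (subst emeasure_distr[OF g_meas]) (auto simp: empty)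
  qed

  define \<rho> where "\<rho> = sqrt (1 - a\<^sup>2)"
  have \<rho>: "\<rho> > 0" using a by (simp add: \<rho>_def abs_square_less_1)
  define m where "m = min \<bar>a\<bar> \<rho>"
  have m: "m > 0" "m \<le> \<bar>a\<bar>" "m \<le> \<rho>" using a \<rho> by (auto simp: m_def)
  define C where "C = 64 * D * (D / m) powr p"
  have C: "C > 0" using D m by (simp add: C_def)
  have "norm (fourier_transform M \<xi>) \<le> C / (1 - p) * norm \<xi> powr - p" if \<xi>: "\<xi> \<noteq> 0" for \<xi>
  proof -
    define ph where "ph x = exp (- 2 * of_real pi * \<i> * complex_of_real (\<xi> \<bullet> x))" for x
    have norm_ph: "norm (ph x) = 1" for x
      using norm_exp_i_times[of "- 2 * pi * (\<xi> \<bullet> x)"] by (simp add: ph_def mult_ac)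
    have ph_meas: "ph \<in> borel_measurable borel"
      unfolding ph_def by (intro borel_measurable_continuous_onI continuous_intros)
    have phg_meas: "(\<lambda>z. ph (g z)) \<in> borel_measurable (uniform_cube J \<Otimes>\<^sub>M uniform01)"
      by (rule measurable_compose[OF g_meas ph_meas])
    define F where "F y = norm (LINT r|uniform01. ph (g (y, r)))" for y
    have int: "integrable (uniform_cube J \<Otimes>\<^sub>M uniform01) (\<lambda>z. ph (g z))"
      using phg_meas by (intro YR.integrable_const_bound[of _ 1]) (auto simp: norm_ph)
    have F_meas: "F \<in> borel_measurable (uniform_cube J)"
      unfolding F_def
      by (intro measurable_compose[OF _ borel_measurable_norm] uniform01.borel_measurable_lebesgue_integral)
        (use phg_meas in \<open>simp add: case_prod_beta\<close>)
    have F1: "F y \<le> 1" for y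
    proof -
      have "F y \<le> (LINT r|uniform01. norm (ph (g (y, r))))"
        unfolding F_def by (rule integral_norm_bound)
      then show ?thesis using uniform01.prob_space by (simp add: norm_ph)
    qed
    have F_w: "\<bar>\<xi> \<bullet> \<theta> y\<bar> * F y \<le> 1" for y
      using segment_phase_integral_le[of "\<xi> \<bullet> \<theta> y" "\<xi> \<bullet> \<tau> (\<theta> y)"]
      by (simp add: F_def ph_def g_def inner_add_right)
    have "fourier_transform M \<xi> = (LINT z|(uniform_cube J \<Otimes>\<^sub>M uniform01). ph (g z))"
      unfolding fourier_transform_def M_def ph_def[symmetric]
      by (rule integral_distr[OF g_meas ph_meas])
    also have "\<dots> = (LINT y|uniform_cube J. LINT r|uniform01. ph (g (y, r)))"
      by (rule YR.integral_fst'[OF int, symmetric])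
    finally have "norm (fourier_transform M \<xi>) \<le> (LINT y|uniform_cube J. F y)"
      unfolding F_def by (simp add: integral_norm_bound)
    also have "\<dots> \<le> C * norm \<xi> powr - p / (1 - p)"
    proof (rule Y.expectation_le_of_tail[OF F_meas])
      fix v :: real assume v: "0 < v" "v \<le> 1"
      obtain \<eta> where \<eta>: "T \<eta> = \<xi>"
        using orthogonal_transformation_surj[OF T(1)] by (metis surj_def)
      then have norm_\<eta>: "norm \<eta> = norm \<xi>"
        using orthogonal_transformation_norm[OF T(1)] by metis
      let ?A = "a * \<eta> $ i0 - \<rho> * \<eta> $ i1" and ?B = "a * \<eta> $ i0 + \<rho> * \<eta> $ i1" and ?b = "\<lambda>j. \<rho> * \<eta> $ j"
      define R where "R = \<bar>?A\<bar> + \<bar>?B\<bar> + (\<Sum>j\<in>J. \<bar>?b j\<bar>)"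
      have "m * norm \<eta> \<le> R"
        using stereographic_coefficients_ge[OF i _ m(2,3)] m(1) by (simp add: R_def J_def)
      then have R: "m * norm \<xi> \<le> R" by (simp add: norm_\<eta>)
      have pos: "0 < m * norm \<xi>" using m \<xi> by simp
      \<comment> \<open>\<open>D\<close> bounds the factor \<open>1 + \<bar>y\<bar>\<^sup>2\<close> on the unit cube.\<close>
      have sub: "{y \<in> space (uniform_cube J). v \<le> F y} \<subseteq>
          {y \<in> space (uniform_cube J). \<bar>round_quadratic ?A ?b ?B J y\<bar> \<le> D / v}"
      proof safe
        fix y assume y: "y \<in> space (uniform_cube J)" and vF: "v \<le> F y"
        have "\<bar>\<xi> \<bullet> \<theta> y\<bar> * v \<le> 1" using mult_left_mono[OF vF, of "\<bar>\<xi> \<bullet> \<theta> y\<bar>"] F_w[of y] by simp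
        then have w: "\<bar>\<xi> \<bullet> \<theta> y\<bar> \<le> 1 / v" using v by (simp add: field_simps)
        have "\<xi> \<bullet> \<theta> y = \<eta> \<bullet> stereographic i0 i1 a y" unfolding \<theta>_def \<eta>[symmetric] T_inner ..
        then have "round_quadratic ?A ?b ?B J y = (\<xi> \<bullet> \<theta> y) * (1 + (\<Sum>j\<in>J. (y j)\<^sup>2))"
          using inner_stereographic[OF i, of \<eta> a y] by (simp add: \<rho>_def J_def)
        then have "\<bar>round_quadratic ?A ?b ?B J y\<bar> = \<bar>\<xi> \<bullet> \<theta> y\<bar> * \<bar>1 + (\<Sum>j\<in>J. (y j)\<^sup>2)\<bar>"
          by (simp only: abs_mult)
        also have "\<dots> \<le> 1 / v * D"
        proof (intro mult_mono w)
          have "(\<Sum>j\<in>J. (y j)\<^sup>2) \<le> real (card J) * 1"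
            using space_uniform_cube[OF y] by (intro sum_bounded_above) (auto intro: power_le_one)
          moreover have "0 \<le> (\<Sum>j\<in>J. (y j)\<^sup>2)" by (simp add: sum_nonneg)
          ultimately show "\<bar>1 + (\<Sum>j\<in>J. (y j)\<^sup>2)\<bar> \<le> D" by (simp add: D_def)
        qed (use v in auto)
        finally show "\<bar>round_quadratic ?A ?b ?B J y\<bar> \<le> D / v" by simp
      qed
      have "Y.prob {y \<in> space (uniform_cube J). v \<le> F y} \<le>
          Y.prob {y \<in> space (uniform_cube J). \<bar>round_quadratic ?A ?b ?B J y\<bar> \<le> D / v}"
        by (rule Y.finite_measure_mono[OF sub round_quadratic_sublevel_sets])
      also have "\<dots> \<le> 64 * (real (card J) + 1) * (D / v / R) powr p"
        using p d J D v pos R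
        by (intro prob_round_quadratic_sublevel_le[OF J(1) p(1) _ _ R_def]) auto
      also have "\<dots> \<le> 64 * D * (D / v / (m * norm \<xi>)) powr p"
        unfolding D_def[symmetric] using p D v R pos m(1)
        by (intro mult_left_mono powr_mono2 divide_left_mono mult_pos_pos) auto
      also have "D / v / (m * norm \<xi>) = D / m * inverse (norm \<xi>) * inverse v"
        by (simp add: field_simps)
      also have "64 * D * (D / m * inverse (norm \<xi>) * inverse v) powr p =
          C * norm \<xi> powr - p * v powr - p"
      proof -
        have "(D / m * inverse (norm \<xi>) * inverse v) powr p =
            (D / m) powr p * inverse (norm \<xi>) powr p * inverse v powr p"
          by (simp only: powr_mult)
        also have "\<dots> = (D / m) powr p * norm \<xi> powr - p * v powr - p"
          by (simp add: inverse_powr powr_minus)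
        finally show ?thesis by (simp add: C_def)
      qed
      finally show "Y.prob {y \<in> space (uniform_cube J). v \<le> F y} \<le> C * norm \<xi> powr - p * v powr - p" .
    qed (use F1 p C in \<open>auto simp: F_def\<close>)
    finally show ?thesis by simp
  qed
  moreover have "C / (1 - p) > 0" using C p by simp
  ultimately show ?thesis using \<open>borel_prob_on E M\<close> by blast
qed

lemma fourier_dim_ge:
  fixes E :: "(real ^ 'n) set"
  assumes "borel_prob_on E M" "C > 0" "0 \<le> s" "s \<le> real CARD('n)"
    "\<And>\<xi>. \<xi> \<noteq> 0 \<Longrightarrow> norm (fourier_transform M \<xi>) \<le> C * norm \<xi> powr (- s / 2)"
  shows "s \<le> fourier_dim E"
  unfolding fourier_dim_def
  by (rule cSup_upper) (use assms in \<open>auto intro!: bdd_aboveI[of _ "real CARD('n)"]\<close>)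

theorem corollary2p6:
  fixes E :: "(real ^ 'n) set"
  assumes "CARD('n) \<ge> 3"
    and "compact E"
    and "\<exists>\<Gamma>. nondegenerate_sphere \<Gamma> \<and> contains_unit_segment_in_directions E \<Gamma>"
  shows "(CARD('n) = 3 \<longrightarrow> fourier_dim E \<ge> 1) \<and> (CARD('n) \<ge> 4 \<longrightarrow> fourier_dim E \<ge> 2)"
proof -
  have dim: "2 * p \<le> fourier_dim E" if p: "0 < p" "p < 1" "p \<le> 1/2 \<or> CARD('n) \<ge> 4" for p
  proof -
    obtain M C where "borel_prob_on E M" "C > 0"
      "\<And>\<xi>. \<xi> \<noteq> 0 \<Longrightarrow> norm (fourier_transform M \<xi>) \<le> C * norm \<xi> powr - p"
      using segment_measure_fourier_decay[OF assms(1,2) _ _ p] assms(3) by blast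
    then show ?thesis using p assms(1) by (intro fourier_dim_ge[of E M C]) auto
  qed
  have one: "1 \<le> fourier_dim E" using dim[of "1/2"] by simp
  have "2 \<le> fourier_dim E" if "CARD('n) \<ge> 4"
  proof (rule ccontr)
    assume less: "\<not> 2 \<le> fourier_dim E"
    \<comment> \<open>With this \<open>p\<close>, the number \<open>2 * p\<close> is the midpoint between the Fourier dimension and \<open>2\<close>.\<close>
    with dim[of "(fourier_dim E + 2) / 4"] one that show False by simp
  qed
  with one show ?thesis by blast
qed

end
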